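(* Let $\Omega\subset\mathbb H$ be a domain. If $f\in C^2(\Omega,\mathbb H)$, then the following identities hold: 1. $-2\,\overline{\mathcal D}\big[\nu[f]\big]=\overline{\mathcal D}\big[\mathbf x\,\mathcal D[f]\big]+\Delta_{\mathbb R^4}[\mathbf x f]+3\,\overline{\mathcal D}[f]$ on $\Omega$; 2. $\Delta_{\mathbb R^4}[f]=\overline{\mathcal D}\Big[\dfrac{\mathbf x}{\|\mathbf x\|^2}\Big(\nu[f]-\sum_{k=0}^3[\mathbf x,\mathrm{Grad}f_k]\,\mathbf e_k\Big)\Big]$ on $\{x\in\Omega\mid\mathbf x\neq0\}$.
   Context: $\mathbb H\cong\mathbb R^4$ is the skew field of real quaternions $x=x_0+x_1\mathbf e_1+x_2\mathbf e_2+x_3\mathbf e_3$, with $\mathbf e_k^2=-1$ and $\mathbf e_1\mathbf e_2\mathbf e_3=-1$; $\mathbf e_0=1$. The vector part of $x$ is $\mathbf x=x_1\mathbf e_1+x_2\mathbf e_2+x_3\mathbf e_3$, identified with $(x_1,x_2,x_3)\in\mathbb R^3$; $\mathbf x$ also denotes the function $x\mapsto\mathbf x$. Write $f=\sum_{k=0}^3 f_k\mathbf e_k$ with $f_k$ real valued and $\partial_k=\partial/\partial x_k$. $\mathcal D[f]=\sum_{k=0}^3\mathbf e_k\partial_kf$ is the (left) Fueter operator, $\overline{\mathcal D}[f]=\partial_0f-\sum_{k=1}^3\mathbf e_k\partial_kf$ is its conjugate, so $\overline{\mathcal D}\circ\mathcal D=\Delta_{\mathbb R^4}=\sum_{k=0}^3\partial_k^2$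 (acting componentwise). $\nu[f]=-\mathbf x\,\partial_0f+\sum_{k=1}^3x_k\partial_kf$. For real valued $u$, $\mathrm{Grad}\,u=\sum_{k=1}^3\mathbf e_k\partial_ku$. $[\mathbf a,\mathbf b]=\frac12(\mathbf a\mathbf b-\mathbf b\mathbf a)$ is the vector (cross) product of $\mathbf a,\mathbf b\in\mathbb R^3$. $[\mathbf x,\mathrm{Grad}f_k]\mathbf e_k$ is a quaternionic product. *)

theory Defs
  imports "HOL-Analysis.Analysis"
begin

section \<open>Quaternions on \<open>\<real>\<^sup>4\<close>\<close>

text \<open>
  A quaternion \<open>x\<^sub>0 + x\<^sub>1 e\<^sub>1 + x\<^sub>2 e\<^sub>2 + x\<^sub>3 e\<^sub>3\<close> is the vector of \<^typ>\<open>real ^ 4\<close> with components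
  \<open>x $ 0\<close>, \<open>x $ 1\<close>, \<open>x $ 2\<close>, \<open>x $ 3\<close>; the elements of the index type \<^typ>\<open>4\<close> are \<open>0, 1, 2, 3\<close>.
  The vector space structure, norm and topology are those of \<^typ>\<open>real ^ 4\<close>. The library's
  \<open>*\<close> on \<^typ>\<open>real ^ 4\<close> is the componentwise product, so the quaternionic product has its own symbol.
\<close>

type_synonym quat = "real ^ 4"

definition qmult :: "quat \<Rightarrow> quat \<Rightarrow> quat" (infixl \<open>*\<^sub>q\<close> 70) where
  "x *\<^sub>q y = (\<chi> i.
     if i = 0 then x $ 0 * y $ 0 - x $ 1 * y $ 1 - x $ 2 * y $ 2 - x $ 3 * y $ 3
     else if i = 1 then x $ 0 * y $ 1 + x $ 1 * y $ 0 + x $ 2 * y $ 3 - x $ 3 * y $ 2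
     else if i = 2 then x $ 0 * y $ 2 - x $ 1 * y $ 3 + x $ 2 * y $ 0 + x $ 3 * y $ 1
     else x $ 0 * y $ 3 + x $ 1 * y $ 2 - x $ 2 * y $ 1 + x $ 3 * y $ 0)"

definition qe :: "4 \<Rightarrow> quat" where
  "qe k = axis k 1"

definition qvec :: "quat \<Rightarrow> quat" where
  "qvec x = (\<Sum>k\<in>{1, 2, 3}. (x $ k) *\<^sub>R qe k)"

definition qcross :: "quat \<Rightarrow> quat \<Rightarrow> quat" where
  "qcross a b = (1 / 2) *\<^sub>R (a *\<^sub>q b - b *\<^sub>q a)"

lemma UNIV_4_from_0: "(UNIV :: 4 set) = {0, 1, 2, 3}"
  using UNIV_4 by auto

lemma quat_eq_iff: "x = y \<longleftrightarrow> x $ 0 = y $ 0 \<and> x $ 1 = y $ 1 \<and> x $ 2 = y $ 2 \<and> x $ 3 = y $ 3"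
  for x y :: quat
proof -
  have "x = y \<longleftrightarrow> (\<forall>i\<in>{0, 1, 2, 3}. x $ i = y $ i)"
    unfolding vec_eq_iff UNIV_4_from_0[symmetric] by simp
  then show ?thesis by simp
qed

lemma qmult_nth:
  "(x *\<^sub>q y) $ 0 = x $ 0 * y $ 0 - x $ 1 * y $ 1 - x $ 2 * y $ 2 - x $ 3 * y $ 3"
  "(x *\<^sub>q y) $ 1 = x $ 0 * y $ 1 + x $ 1 * y $ 0 + x $ 2 * y $ 3 - x $ 3 * y $ 2"
  "(x *\<^sub>q y) $ 2 = x $ 0 * y $ 2 - x $ 1 * y $ 3 + x $ 2 * y $ 0 + x $ 3 * y $ 1"
  "(x *\<^sub>q y) $ 3 = x $ 0 * y $ 3 + x $ 1 * y $ 2 - x $ 2 * y $ 1 + x $ 3 * y $ 0"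
  by (simp_all add: qmult_def)

lemma qmult_assoc: "(x *\<^sub>q y) *\<^sub>q z = x *\<^sub>q (y *\<^sub>q z)"
  by (simp add: quat_eq_iff qmult_nth algebra_simps)

lemma qmult_relations:
  "qe 0 *\<^sub>q x = x" "x *\<^sub>q qe 0 = x"
  "qe 1 *\<^sub>q qe 1 = - qe 0" "qe 2 *\<^sub>q qe 2 = - qe 0" "qe 3 *\<^sub>q qe 3 = - qe 0"
  "qe 1 *\<^sub>q qe 2 *\<^sub>q qe 3 = - qe 0"
  by (simp_all add: quat_eq_iff qmult_nth qe_def axis_def)

lemma bilinear_qmult: "bilinear (*\<^sub>q)"
  by (auto simp: bilinear_def quat_eq_iff qmult_nth algebra_simps intro!: linearI)

section \<open>Differential operators\<close>

definition partial :: "4 \<Rightarrow> (quat \<Rightarrow> 'b::real_normed_vector) \<Rightarrow> quat \<Rightarrow> 'b" where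
  "partial k f x = vector_derivative (\<lambda>t. f (x + t *\<^sub>R qe k)) (at 0)"

definition has_partials_on :: "(quat \<Rightarrow> 'b::real_normed_vector) \<Rightarrow> quat set \<Rightarrow> bool" where
  "has_partials_on f S \<longleftrightarrow> (\<forall>k. \<forall>x\<in>S. (\<lambda>t. f (x + t *\<^sub>R qe k)) differentiable at 0)"

text \<open>\<open>Ck_on n f S\<close>: on the open set \<open>S\<close>, all iterated partial derivatives of \<open>f\<close> of order at most
  \<open>n\<close> exist and are continuous.\<close>

fun Ck_on :: "nat \<Rightarrow> (quat \<Rightarrow> 'b::real_normed_vector) \<Rightarrow> quat set \<Rightarrow> bool" where
  "Ck_on 0 f S \<longleftrightarrow> continuous_on S f"
| "Ck_on (Suc n) f S \<longleftrightarrow>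
     continuous_on S f \<and> has_partials_on f S \<and> (\<forall>k. Ck_on n (partial k f) S)"

definition fueter :: "(quat \<Rightarrow> quat) \<Rightarrow> quat \<Rightarrow> quat" where
  "fueter f x = (\<Sum>k\<in>UNIV. qe k *\<^sub>q partial k f x)"

definition fueter_conj :: "(quat \<Rightarrow> quat) \<Rightarrow> quat \<Rightarrow> quat" where
  "fueter_conj f x = partial 0 f x - (\<Sum>k\<in>{1, 2, 3}. qe k *\<^sub>q partial k f x)"

definition laplacian :: "(quat \<Rightarrow> quat) \<Rightarrow> quat \<Rightarrow> quat" where
  "laplacian f x = (\<Sum>k\<in>UNIV. partial k (partial k f) x)"

definition nu :: "(quat \<Rightarrow> quat) \<Rightarrow> quat \<Rightarrow> quat" where
  "nu f x = - (qvec x *\<^sub>q partial 0 f x) + (\<Sum>k\<in>{1, 2, 3}. (x $ k) *\<^sub>R partial k f x)"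

definition Grad :: "(quat \<Rightarrow> real) \<Rightarrow> quat \<Rightarrow> quat" where
  "Grad u x = (\<Sum>k\<in>{1, 2, 3}. partial k u x *\<^sub>R qe k)"

end

theory Submission
  imports Defs
begin

text \<open>
  Both identities reduce to first order calculations with the left Fueter operator \<open>D\<close>.
  Write \<open>V = \<Sum>\<^sub>k e\<^sub>k \<partial>\<^sub>k\<close> and \<open>E = \<Sum>\<^sub>k x\<^sub>k \<partial>\<^sub>k\<close> with \<open>k\<close> from \<open>1\<close> to \<open>3\<close>, so that
  \<open>D = \<partial>\<^sub>0 + V\<close>, the conjugate operator is \<open>D' = \<partial>\<^sub>0 - V\<close>, and \<open>\<nu> = - x \<partial>\<^sub>0 + E\<close>, where \<open>x\<close> stands
  for the vector part. The commutation relation \<open>e\<^sub>k x + x e\<^sub>k = - 2 x\<^sub>k\<close> and the Leibniz rule give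
  \<open>D'[x g] = x D g + 3 g + 2 E g\<close> (lemma \<open>fueter_conj_qvec_mult\<close>), and for functions of class
  \<open>C\<^sup>2\<close> they give \<open>\<Delta>[x f] = x \<Delta> f + 2 V f\<close> and \<open>D'[E f] = E D' f - V f\<close>
  (lemmas \<open>laplacian_qvec_mult\<close> and \<open>fueter_conj_euler_vec\<close>).

  For the first identity, these formulas turn \<open>- 2 D'[\<nu> f]\<close> into
  \<open>2 x D \<partial>\<^sub>0 f + 6 \<partial>\<^sub>0 f + 4 E \<partial>\<^sub>0 f - 2 E D' f + 2 V f\<close>. It remains to replace every \<open>2 \<partial>\<^sub>0\<close> by
  \<open>D + D'\<close>: then \<open>2 D \<partial>\<^sub>0 f = D D f + \<Delta> f\<close> since \<open>D' D = \<Delta>\<close>, and regrouping yields the right hand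
  side.

  The second identity is \<open>D' D = \<Delta>\<close> in disguise, because the argument of \<open>D'\<close> in it is \<open>D f\<close> itself.
  Indeed \<open>V f = \<Sum>\<^sub>k (Grad f\<^sub>k) e\<^sub>k\<close>, and \<open>x (Grad f\<^sub>k)\<close> is the cross product \<open>[x, Grad f\<^sub>k]\<close> minus
  the scalar product \<open>E f\<^sub>k\<close>; hence \<open>\<nu> f - \<Sum>\<^sub>k [x, Grad f\<^sub>k] e\<^sub>k = - x D f\<close>
  (lemma \<open>nu_minus_cross_Grad\<close>), and \<open>x x = - \<bar>x\<bar>\<^sup>2\<close> (lemma \<open>qvec_cancel_left\<close>).

  The factorisation \<open>D' D = \<Delta>\<close> and the interchange of \<open>D\<close> with \<open>\<partial>\<^sub>k\<close> rest on the symmetry of mixed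
  second derivatives, proved here for directional derivatives by means of second differences.
\<close>

section \<open>Symmetry of mixed directional derivatives\<close>

lemma has_directional_derivative_shift:
  fixes \<phi> :: "'a::real_normed_vector \<Rightarrow> real"
  assumes "((\<lambda>t. \<phi> (a + s *\<^sub>R u + t *\<^sub>R u)) has_vector_derivative D) (at 0)"
  shows "((\<lambda>t. \<phi> (a + t *\<^sub>R u)) has_real_derivative D) (at s)"
proof -
  have "((\<lambda>t. \<phi> (a + (t + s) *\<^sub>R u)) has_real_derivative D) (at 0)"
    using assms by (simp add: has_real_derivative_iff_has_vector_derivative algebra_simps)
  then show ?thesis
    using DERIV_shift[of "\<lambda>t. \<phi> (a + t *\<^sub>R u)" D 0 s] by simp
qed

text \<open>
  Two applications of the mean value theorem, one in each direction. The second difference on the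
  left is symmetric in \<open>u\<close> and \<open>v\<close>, so the lemma can be used in both orders of differentiation.
\<close>

lemma second_difference_mean_value:
  fixes \<phi> :: "'a::real_normed_vector \<Rightarrow> real"
  assumes "0 < h"
    and square: "\<And>s t. s \<in> {0..h} \<Longrightarrow> t \<in> {0..h} \<Longrightarrow> x + s *\<^sub>R u + t *\<^sub>R v \<in> S"
    and du: "\<And>y. y \<in> S \<Longrightarrow> ((\<lambda>t. \<phi> (y + t *\<^sub>R u)) has_vector_derivative \<phi>u y) (at 0)"
    and duv: "\<And>y. y \<in> S \<Longrightarrow> ((\<lambda>t. \<phi>u (y + t *\<^sub>R v)) has_vector_derivative \<phi>uv y) (at 0)"
  shows "\<exists>s\<in>{0..h}. \<exists>t\<in>{0..h}.
    \<phi> (x + h *\<^sub>R u + h *\<^sub>R v) - \<phi> (x + h *\<^sub>R u) - \<phi> (x + h *\<^sub>R v) + \<phi> x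
      = h * h * \<phi>uv (x + s *\<^sub>R u + t *\<^sub>R v)"
proof -
  let ?g = "\<lambda>s. \<phi> (x + h *\<^sub>R v + s *\<^sub>R u) - \<phi> (x + s *\<^sub>R u)"
  have "(?g has_real_derivative \<phi>u (x + s *\<^sub>R u + h *\<^sub>R v) - \<phi>u (x + s *\<^sub>R u)) (at s)"
    if "0 \<le> s" "s \<le> h" for s
  proof -
    have "x + s *\<^sub>R u + h *\<^sub>R v \<in> S" "x + s *\<^sub>R u \<in> S"
      using square[of s h] square[of s 0] that \<open>0 < h\<close> by auto
    from this[THEN du] show ?thesis
      by (intro DERIV_diff has_directional_derivative_shift) (simp_all add: algebra_simps)
  qed
  from MVT2[OF \<open>0 < h\<close> this] obtain s where s: "0 < s" "s < h"
    and gs: "?g h - ?g 0 = h * (\<phi>u (x + s *\<^sub>R u + h *\<^sub>R v) - \<phi>u (x + s *\<^sub>R u))"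
    by auto
  have "((\<lambda>t. \<phi>u (x + s *\<^sub>R u + t *\<^sub>R v)) has_real_derivative \<phi>uv (x + s *\<^sub>R u + t *\<^sub>R v)) (at t)"
    if "0 \<le> t" "t \<le> h" for t
    using s that by (intro has_directional_derivative_shift duv square) auto
  from MVT2[OF \<open>0 < h\<close> this] obtain t where t: "0 < t" "t < h"
    and kt: "\<phi>u (x + s *\<^sub>R u + h *\<^sub>R v) - \<phi>u (x + s *\<^sub>R u) = h * \<phi>uv (x + s *\<^sub>R u + t *\<^sub>R v)"
    by auto
  show ?thesis
    using s t gs unfolding kt
    by (intro bexI[of _ s] bexI[of _ t]) (auto simp: algebra_simps)
qed

text \<open>
  On small parallelograms at \<open>x\<close> the same second difference equals \<open>h\<^sup>2\<close> times a value of each of the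
  two mixed derivatives near \<open>x\<close>, and both are continuous at \<open>x\<close>. The hypotheses ask for
  derivatives along two directions only, since this is what existence of partial derivatives provides.
\<close>

lemma mixed_directional_derivatives_commute_real:
  fixes \<phi> :: "'a::real_normed_vector \<Rightarrow> real"
  assumes "open S" "x \<in> S"
    and du: "\<And>y. y \<in> S \<Longrightarrow> ((\<lambda>t. \<phi> (y + t *\<^sub>R u)) has_vector_derivative \<phi>u y) (at 0)"
    and dv: "\<And>y. y \<in> S \<Longrightarrow> ((\<lambda>t. \<phi> (y + t *\<^sub>R v)) has_vector_derivative \<phi>v y) (at 0)"
    and duv: "\<And>y. y \<in> S \<Longrightarrow> ((\<lambda>t. \<phi>u (y + t *\<^sub>R v)) has_vector_derivative \<phi>uv y) (at 0)"
    and dvu: "\<And>y. y \<in> S \<Longrightarrow> ((\<lambda>t. \<phi>v (y + t *\<^sub>R u)) has_vector_derivative \<phi>vu y) (at 0)"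
    and cont: "continuous_on S \<phi>uv" "continuous_on S \<phi>vu"
  shows "\<phi>uv x = \<phi>vu x"
proof (rule ccontr)
  assume "\<phi>uv x \<noteq> \<phi>vu x"
  define e where "e = \<bar>\<phi>uv x - \<phi>vu x\<bar> / 2"
  have "0 < e" using \<open>\<phi>uv x \<noteq> \<phi>vu x\<close> by (simp add: e_def)
  have "isCont \<phi>uv x" "isCont \<phi>vu x"
    using cont \<open>open S\<close> \<open>x \<in> S\<close> by (auto simp: continuous_on_eq_continuous_at)
  then have "\<exists>d>0. \<forall>y. dist y x < d \<longrightarrow> dist (\<phi>uv y) (\<phi>uv x) < e"
    "\<exists>d>0. \<forall>y. dist y x < d \<longrightarrow> dist (\<phi>vu y) (\<phi>vu x) < e"
    using \<open>0 < e\<close> unfolding continuous_at_eps_delta by simp_all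
  then obtain d1 d2 where d: "0 < d1" "0 < d2"
    and d1: "\<And>y. dist y x < d1 \<Longrightarrow> dist (\<phi>uv y) (\<phi>uv x) < e"
    and d2: "\<And>y. dist y x < d2 \<Longrightarrow> dist (\<phi>vu y) (\<phi>vu x) < e"
    by blast
  obtain d0 where d0: "0 < d0" "ball x d0 \<subseteq> S"
    using \<open>open S\<close> \<open>x \<in> S\<close> open_contains_ball by blast
  \<comment> \<open>With this \<open>h\<close> the parallelogram with sides \<open>h u\<close> and \<open>h v\<close> at \<open>x\<close> lies within distance \<open>r\<close> of \<open>x\<close>;
     the summand \<open>1\<close> in the denominator covers the case \<open>u = v = 0\<close>.\<close>
  define r where "r = min d0 (min d1 d2)"
  define h where "h = r / (1 + norm u + norm v)"
  have "0 < r" using d d0 by (simp add: r_def)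
  have pos: "0 < 1 + norm u + norm v" by (simp add: add_pos_nonneg)
  have "0 < h" unfolding h_def using \<open>0 < r\<close> pos by simp
  have near: "dist (x + s *\<^sub>R u + t *\<^sub>R v) x < r" if "s \<in> {0..h}" "t \<in> {0..h}" for s t
  proof -
    have "dist (x + s *\<^sub>R u + t *\<^sub>R v) x = norm (s *\<^sub>R u + t *\<^sub>R v)"
      by (simp add: dist_norm add.assoc)
    also have "\<dots> \<le> s * norm u + t * norm v"
      using that norm_triangle_ineq[of "s *\<^sub>R u" "t *\<^sub>R v"] by simp
    also have "\<dots> \<le> h * norm u + h * norm v"
      using that by (intro add_mono mult_right_mono) auto
    also have "\<dots> < h * (1 + norm u + norm v)"
      using \<open>0 < h\<close> by (simp add: algebra_simps)
    also have "\<dots> = r" using pos by (simp add: h_def)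
    finally show ?thesis .
  qed
  have inS: "x + s *\<^sub>R u + t *\<^sub>R v \<in> S" if "s \<in> {0..h}" "t \<in> {0..h}" for s t
    using near[OF that] d0(2) by (auto simp: r_def dist_commute)
  obtain s t where st: "s \<in> {0..h}" "t \<in> {0..h}" and
    1: "\<phi> (x + h *\<^sub>R u + h *\<^sub>R v) - \<phi> (x + h *\<^sub>R u) - \<phi> (x + h *\<^sub>R v) + \<phi> x
      = h * h * \<phi>uv (x + s *\<^sub>R u + t *\<^sub>R v)"
    using second_difference_mean_value[OF \<open>0 < h\<close> inS du duv] by blast
  have inS': "x + t *\<^sub>R v + s *\<^sub>R u \<in> S" if "t \<in> {0..h}" "s \<in> {0..h}" for s t
    using inS[OF that(2,1)] by (simp add: algebra_simps)
  obtain s' t' where st': "s' \<in> {0..h}" "t' \<in> {0..h}" and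
    2: "\<phi> (x + h *\<^sub>R v + h *\<^sub>R u) - \<phi> (x + h *\<^sub>R v) - \<phi> (x + h *\<^sub>R u) + \<phi> x
      = h * h * \<phi>vu (x + t' *\<^sub>R v + s' *\<^sub>R u)"
    using second_difference_mean_value[OF \<open>0 < h\<close> inS' dv dvu] by blast
  have "h * h * \<phi>uv (x + s *\<^sub>R u + t *\<^sub>R v) = h * h * \<phi>vu (x + s' *\<^sub>R u + t' *\<^sub>R v)"
    using 1 2 by (simp add: algebra_simps)
  then have "\<phi>uv (x + s *\<^sub>R u + t *\<^sub>R v) = \<phi>vu (x + s' *\<^sub>R u + t' *\<^sub>R v)"
    using \<open>0 < h\<close> by simp
  moreover have "dist (\<phi>uv (x + s *\<^sub>R u + t *\<^sub>R v)) (\<phi>uv x) < e"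
    using near[OF st] by (intro d1) (simp add: r_def)
  moreover have "dist (\<phi>vu (x + s' *\<^sub>R u + t' *\<^sub>R v)) (\<phi>vu x) < e"
    using near[OF st'] by (intro d2) (simp add: r_def)
  ultimately have "\<bar>\<phi>uv x - \<phi>vu x\<bar> < 2 * e"
    by (simp add: dist_real_def)
  then show False by (simp add: e_def)
qed

lemma mixed_directional_derivatives_commute:
  fixes f :: "'a::real_normed_vector \<Rightarrow> 'b::euclidean_space"
  assumes "open S" "x \<in> S"
    and du: "\<And>y. y \<in> S \<Longrightarrow> ((\<lambda>t. f (y + t *\<^sub>R u)) has_vector_derivative fu y) (at 0)"
    and dv: "\<And>y. y \<in> S \<Longrightarrow> ((\<lambda>t. f (y + t *\<^sub>R v)) has_vector_derivative fv y) (at 0)"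
    and duv: "\<And>y. y \<in> S \<Longrightarrow> ((\<lambda>t. fu (y + t *\<^sub>R v)) has_vector_derivative fuv y) (at 0)"
    and dvu: "\<And>y. y \<in> S \<Longrightarrow> ((\<lambda>t. fv (y + t *\<^sub>R u)) has_vector_derivative fvu y) (at 0)"
    and cont: "continuous_on S fuv" "continuous_on S fvu"
  shows "fuv x = fvu x"
proof (rule euclidean_eqI)
  fix b :: 'b assume "b \<in> Basis"
  note inner = bounded_linear.has_vector_derivative[OF bounded_linear_inner_left[of b]]
  show "fuv x \<bullet> b = fvu x \<bullet> b"
    by (rule mixed_directional_derivatives_commute_real
        [where \<phi>="\<lambda>y. f y \<bullet> b" and \<phi>u="\<lambda>y. fu y \<bullet> b" and \<phi>v="\<lambda>y. fv y \<bullet> b" and u=u and v=v])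
      (use assms(1,2) in \<open>auto intro!: inner du dv duv dvu continuous_on_inner cont continuous_on_const\<close>)
qed

section \<open>Calculus of partial derivatives\<close>

text \<open>
  The operator \<open>partial\<close> has an arbitrary value where the derivative does not exist; the calculus
  rules are therefore stated for a relation that includes existence.
\<close>

definition has_partial :: "4 \<Rightarrow> (quat \<Rightarrow> 'b::real_normed_vector) \<Rightarrow> 'b \<Rightarrow> quat \<Rightarrow> bool" where
  "has_partial k f D x \<longleftrightarrow> ((\<lambda>t. f (x + t *\<^sub>R qe k)) has_vector_derivative D) (at 0)"

lemma partial_eqI: "has_partial k f D x \<Longrightarrow> partial k f x = D"
  unfolding has_partial_def partial_def by (rule vector_derivative_at)

lemma has_partial_partial: "has_partial k f D x \<Longrightarrow> has_partial k f (partial k f x) x"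
  by (simp add: partial_eqI)

lemma has_partials_onD: "has_partials_on f S \<Longrightarrow> x \<in> S \<Longrightarrow> has_partial k f (partial k f x) x"
  unfolding has_partials_on_def has_partial_def partial_def
  by (simp add: vector_derivative_works)

lemma has_partial_cong_open:
  assumes "has_partial k f D x" "open S" "x \<in> S" "\<And>y. y \<in> S \<Longrightarrow> f y = g y"
  shows "has_partial k g D x"
proof -
  have "open ((\<lambda>t. x + t *\<^sub>R qe k) -` S)"
    by (rule open_vimage[OF \<open>open S\<close>]) (intro continuous_intros)
  then show ?thesis
    using assms unfolding has_partial_def
    by (elim has_vector_derivative_transform_within_open) auto
qed

lemma partial_cong_open:
  assumes "has_partial k f (partial k f x) x" "open S" "x \<in> S" "\<And>y. y \<in> S \<Longrightarrow> f y = g y"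
  shows "partial k g x = partial k f x"
  by (rule partial_eqI, rule has_partial_cong_open[OF assms])

lemma has_partial_add:
  "has_partial k f D x \<Longrightarrow> has_partial k g E x \<Longrightarrow> has_partial k (\<lambda>y. f y + g y) (D + E) x"
  unfolding has_partial_def by (rule has_vector_derivative_add)

lemma has_partial_minus: "has_partial k f D x \<Longrightarrow> has_partial k (\<lambda>y. - f y) (- D) x"
  unfolding has_partial_def by (rule has_vector_derivative_minus)

lemma has_partial_sum:
  "(\<And>i. i \<in> I \<Longrightarrow> has_partial k (f i) (D i) x) \<Longrightarrow>
    has_partial k (\<lambda>y. \<Sum>i\<in>I. f i y) (\<Sum>i\<in>I. D i) x"
  unfolding has_partial_def by (rule has_vector_derivative_sum)

lemma has_partial_linear:
  assumes "bounded_linear L" "has_partial k f D x"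
  shows "has_partial k (\<lambda>y. L (f y)) (L D) x"
  using bounded_linear.has_vector_derivative[OF assms(1)] assms(2) unfolding has_partial_def .

lemma has_partial_ident: "has_partial k (\<lambda>y. y) (qe k) x"
  unfolding has_partial_def by (auto intro!: derivative_eq_intros)

lemma bounded_bilinear_qmult: "bounded_bilinear (*\<^sub>q)"
  using bilinear_qmult by (simp add: bilinear_conv_bounded_bilinear)

lemmas bounded_linear_qmult_right = bounded_bilinear.bounded_linear_right[OF bounded_bilinear_qmult]

lemma has_partial_qmult:
  assumes "has_partial k f D x" "has_partial k g E x"
  shows "has_partial k (\<lambda>y. f y *\<^sub>q g y) (f x *\<^sub>q E + D *\<^sub>q g x) x"
  using bounded_bilinear.has_vector_derivative[OF bounded_bilinear_qmult
      assms(1)[unfolded has_partial_def] assms(2)[unfolded has_partial_def]]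
  by (simp add: has_partial_def)

lemma has_partial_coordinate_scaleR:
  assumes "has_partial k g E x"
  shows "has_partial k (\<lambda>y. (y $ i) *\<^sub>R g y) ((x $ i) *\<^sub>R E + (qe k $ i) *\<^sub>R g x) x"
  using bounded_bilinear.has_vector_derivative[OF bounded_bilinear_scaleR
      has_partial_linear[OF bounded_linear_vec_nth has_partial_ident, unfolded has_partial_def]
      assms[unfolded has_partial_def]]
  by (simp add: has_partial_def)

lemma sum_indices: "sum g (UNIV :: 4 set) = g 0 + (g 1 + (g 2 + g 3))"
  for g :: "4 \<Rightarrow> 'b::comm_monoid_add"
  unfolding UNIV_4_from_0 by simp

lemma qe_nth: "qe k $ i = (if i = k then 1 else 0)"
  by (simp add: qe_def axis_def)

lemma qvec_nth: "qvec x $ 0 = 0" "qvec x $ 1 = x $ 1" "qvec x $ 2 = x $ 2" "qvec x $ 3 = x $ 3"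
  by (simp_all add: qvec_def qe_nth)

lemma has_partial_qvec: "has_partial k qvec (qvec (qe k)) x"
proof -
  have "linear qvec"
    by (rule linearI) (simp_all add: quat_eq_iff qvec_nth)
  then have "bounded_linear qvec"
    by (simp add: linear_linear)
  from has_partial_linear[OF this has_partial_ident] show ?thesis .
qed

section \<open>Operators of first order\<close>

text \<open>
  The operators \<open>E\<close> and \<open>V\<close> of the introduction are the Euler (radial) operator and the Dirac operator
  of the three-dimensional space of vector parts.
\<close>

definition euler_vec :: "(quat \<Rightarrow> quat) \<Rightarrow> quat \<Rightarrow> quat" where
  "euler_vec g x = (\<Sum>k\<in>{1, 2, 3}. (x $ k) *\<^sub>R partial k g x)"

definition dirac :: "(quat \<Rightarrow> quat) \<Rightarrow> quat \<Rightarrow> quat" where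
  "dirac g x = (\<Sum>k\<in>{1, 2, 3}. qe k *\<^sub>q partial k g x)"

lemma fueter_eq_dirac: "fueter g x = partial 0 g x + dirac g x"
  by (simp add: fueter_def dirac_def sum_indices qmult_relations)

lemma fueter_conj_eq_dirac: "fueter_conj g x = partial 0 g x - dirac g x"
  by (simp add: fueter_conj_def dirac_def)

lemma nu_eq_euler_vec: "nu g x = - (qvec x *\<^sub>q partial 0 g x) + euler_vec g x"
  by (simp add: nu_def euler_vec_def)

lemma fueter_conj_cong_open:
  assumes "\<And>k. has_partial k g (partial k g x) x" "open S" "x \<in> S" "\<And>y. y \<in> S \<Longrightarrow> g y = h y"
  shows "fueter_conj h x = fueter_conj g x"
  unfolding fueter_conj_def by (simp add: partial_cong_open[OF assms])

text \<open>
  The Leibniz rule produces \<open>x \<partial>\<^sub>0 g - \<Sum>\<^sub>k e\<^sub>k x \<partial>\<^sub>k g - \<Sum>\<^sub>k e\<^sub>k e\<^sub>k g\<close>. The last sum is \<open>- 3 g\<close>, and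
  moving \<open>x\<close> to the left of \<open>e\<^sub>k\<close> with \<open>e\<^sub>k x = - x e\<^sub>k - 2 x\<^sub>k\<close> turns \<open>D'\<close> into \<open>D\<close> at the price of
  the Euler term.
\<close>

lemma fueter_conj_qvec_mult:
  assumes "\<And>k. has_partial k g (partial k g x) x"
  shows "fueter_conj (\<lambda>y. qvec y *\<^sub>q g y) x
    = qvec x *\<^sub>q fueter g x + 3 *\<^sub>R g x + 2 *\<^sub>R euler_vec g x"
proof -
  have *: "partial k (\<lambda>y. qvec y *\<^sub>q g y) x = qvec x *\<^sub>q partial k g x + qvec (qe k) *\<^sub>q g x" for k
    by (intro partial_eqI has_partial_qmult has_partial_qvec assms)
  show ?thesis
    by (simp add: * fueter_conj_def fueter_def euler_vec_def sum_indices quat_eq_iff qmult_nth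
        qvec_nth qe_nth algebra_simps)
qed

text \<open>
  The product of the vectors \<open>x\<close> and \<open>Grad f\<^sub>k\<close> splits into minus their scalar product and their cross
  product. Multiplied by \<open>e\<^sub>k\<close> on the right and summed, the scalar products give \<open>E f\<close> and the full
  products give \<open>x V f\<close>.
\<close>

lemma nu_minus_cross_Grad:
  assumes "\<And>k. has_partial k f (partial k f y) y"
  shows "nu f y - (\<Sum>k\<in>UNIV. qcross (qvec y) (Grad (\<lambda>z. f z $ k) y) *\<^sub>q qe k)
    = - (qvec y *\<^sub>q fueter f y)"
proof -
  have *: "partial j (\<lambda>z. f z $ k) y = partial j f y $ k" for j k
    by (intro partial_eqI has_partial_linear[OF bounded_linear_vec_nth] assms)
  show ?thesis
    by (simp add: * nu_def fueter_def Grad_def qcross_def sum_indices quat_eq_iff qmult_nth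
        qvec_nth qe_nth algebra_simps)
qed

lemma qvec_cancel_left:
  assumes "qvec y \<noteq> 0"
  shows "((1 / (norm (qvec y))\<^sup>2) *\<^sub>R qvec y) *\<^sub>q (- (qvec y *\<^sub>q a)) = a"
proof -
  have n: "(norm (qvec y))\<^sup>2 = (y $ 1)\<^sup>2 + (y $ 2)\<^sup>2 + (y $ 3)\<^sup>2"
    by (simp add: norm_vec_def L2_set_def sum_indices qvec_nth sum_nonneg)
  have "qvec y *\<^sub>q (- (qvec y *\<^sub>q a)) = (norm (qvec y))\<^sup>2 *\<^sub>R a"
    unfolding n by (simp add: quat_eq_iff qmult_nth qvec_nth power2_eq_square algebra_simps)
  then show ?thesis
    using assms by (simp add: bounded_bilinear.scaleR_left[OF bounded_bilinear_qmult])
qed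

section \<open>Operators of second order\<close>

locale C2_function =
  fixes \<Omega> :: "quat set" and f :: "quat \<Rightarrow> quat"
  assumes opn: "open \<Omega>" and C2: "Ck_on 2 f \<Omega>"
begin

lemma has_partial1: "x \<in> \<Omega> \<Longrightarrow> has_partial k f (partial k f x) x"
  using C2 by (auto simp: numeral_2_eq_2 intro: has_partials_onD)

lemma has_partial2:
  "x \<in> \<Omega> \<Longrightarrow> has_partial k (partial j f) (partial k (partial j f) x) x"
  using C2 by (auto simp: numeral_2_eq_2 intro: has_partials_onD)

lemma partial_commute:
  assumes "x \<in> \<Omega>"
  shows "partial k (partial j f) x = partial j (partial k f) x"
  using C2 by (intro mixed_directional_derivatives_commute[OF opn assms
        has_partial1[unfolded has_partial_def] has_partial1[unfolded has_partial_def]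
        has_partial2[unfolded has_partial_def] has_partial2[unfolded has_partial_def]])
    (simp_all add: numeral_2_eq_2)

lemma has_partial_dirac: "x \<in> \<Omega> \<Longrightarrow> has_partial k (dirac f) (dirac (partial k f) x) x"
  unfolding dirac_def[abs_def]
  by (subst partial_commute[symmetric], assumption)
     (intro has_partial_sum has_partial_linear[OF bounded_linear_qmult_right] has_partial2)

lemma has_partial_fueter: "x \<in> \<Omega> \<Longrightarrow> has_partial k (fueter f) (fueter (partial k f) x) x"
  unfolding fueter_eq_dirac[abs_def] partial_commute[of x 0 k]
  by (intro has_partial_add has_partial2 has_partial_dirac)

lemma has_partial_fueter_conj:
  "x \<in> \<Omega> \<Longrightarrow> has_partial k (fueter_conj f) (fueter_conj (partial k f) x) x"
  unfolding fueter_conj_eq_dirac[abs_def] diff_conv_add_uminus partial_commute[of x 0 k]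
  by (intro has_partial_add has_partial_minus has_partial2 has_partial_dirac)

text \<open>
  In \<open>(\<partial>\<^sub>0 - V) (\<partial>\<^sub>0 + V)\<close> the mixed terms cancel: those with \<open>\<partial>\<^sub>0\<close> because of the opposite signs,
  those inside \<open>V V\<close> because \<open>e\<^sub>j e\<^sub>k = - e\<^sub>k e\<^sub>j\<close> while \<open>\<partial>\<^sub>j \<partial>\<^sub>k = \<partial>\<^sub>k \<partial>\<^sub>j\<close>.
\<close>

lemma fueter_conj_fueter:
  assumes "x \<in> \<Omega>"
  shows "fueter_conj (fueter f) x = laplacian f x"
proof -
  have *: "partial k (fueter f) x = fueter (partial k f) x" for k
    using has_partial_fueter[OF assms] by (rule partial_eqI)
  show ?thesis
    by (simp add: * fueter_conj_def fueter_def laplacian_def sum_indices quat_eq_iff qmult_nth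
        qe_nth partial_commute[OF assms] algebra_simps)
qed

text \<open>
  The vector part is linear, so in \<open>\<partial>\<^sub>k \<partial>\<^sub>k (x f)\<close> its second derivative drops out and the cross term
  \<open>(\<partial>\<^sub>k x) (\<partial>\<^sub>k f)\<close> appears twice, with \<open>\<partial>\<^sub>k x = e\<^sub>k\<close> for \<open>k \<ge> 1\<close> and \<open>\<partial>\<^sub>0 x = 0\<close>.
\<close>

lemma laplacian_qvec_mult:
  assumes "x \<in> \<Omega>"
  shows "laplacian (\<lambda>y. qvec y *\<^sub>q f y) x = qvec x *\<^sub>q laplacian f x + 2 *\<^sub>R dirac f x"
proof -
  have first: "partial k (\<lambda>y. qvec y *\<^sub>q f y) y = qvec y *\<^sub>q partial k f y + qvec (qe k) *\<^sub>q f y"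
    if "y \<in> \<Omega>" for k y
    using that by (intro partial_eqI has_partial_qmult has_partial_qvec has_partial1)
  have *: "partial k (partial k (\<lambda>y. qvec y *\<^sub>q f y)) x
      = qvec x *\<^sub>q partial k (partial k f) x + qvec (qe k) *\<^sub>q partial k f x
        + qvec (qe k) *\<^sub>q partial k f x" for k
    by (rule partial_eqI, rule has_partial_cong_open[OF _ opn assms first[symmetric]])
      (intro has_partial_add has_partial_qmult has_partial_qvec has_partial2 assms
        has_partial_linear[OF bounded_linear_qmult_right] has_partial1, simp_all)
  show ?thesis
    by (simp add: * laplacian_def dirac_def sum_indices quat_eq_iff qmult_nth qvec_nth qe_nth
        algebra_simps)
qed

lemma has_partial_euler_vec:
  assumes "x \<in> \<Omega>"
  shows "has_partial k (euler_vec f)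
    (\<Sum>j\<in>{1, 2, 3}. (x $ j) *\<^sub>R partial k (partial j f) x + (qe k $ j) *\<^sub>R partial j f x) x"
  unfolding euler_vec_def[abs_def]
  by (intro has_partial_sum has_partial_coordinate_scaleR has_partial2 assms)

text \<open>
  The commutator of \<open>D'\<close> with \<open>E\<close> comes from differentiating the
  coefficients \<open>x\<^sub>k\<close> of \<open>E\<close>, which contributes an extra \<open>- e\<^sub>k \<partial>\<^sub>k f\<close> for every \<open>k \<ge> 1\<close>.
\<close>

lemma fueter_conj_euler_vec:
  assumes "x \<in> \<Omega>"
  shows "fueter_conj (euler_vec f) x = euler_vec (fueter_conj f) x - dirac f x"
proof -
  have *: "partial k (fueter_conj f) x = fueter_conj (partial k f) x" for k
    using has_partial_fueter_conj[OF assms] by (rule partial_eqI)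
  show ?thesis
    by (simp add: * partial_eqI[OF has_partial_euler_vec[OF assms]] fueter_conj_def euler_vec_def
        dirac_def quat_eq_iff qmult_nth qe_nth algebra_simps)
qed

lemma fueter_plus_fueter_conj:
  "fueter g x + fueter_conj g x = 2 *\<^sub>R partial 0 g x"
  by (simp add: fueter_eq_dirac fueter_conj_eq_dirac scaleR_2)

lemma euler_vec_fueter_plus_conj:
  assumes "x \<in> \<Omega>"
  shows "euler_vec (fueter f) x + euler_vec (fueter_conj f) x = 2 *\<^sub>R euler_vec (partial 0 f) x"
proof -
  have *: "partial k (fueter f) x + partial k (fueter_conj f) x = 2 *\<^sub>R partial k (partial 0 f) x" for k
    unfolding partial_eqI[OF has_partial_fueter[OF assms]]
      partial_eqI[OF has_partial_fueter_conj[OF assms]]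
      fueter_plus_fueter_conj partial_commute[OF assms, of 0 k] ..
  have "(x $ k) *\<^sub>R partial k (fueter f) x + (x $ k) *\<^sub>R partial k (fueter_conj f) x
      = 2 *\<^sub>R ((x $ k) *\<^sub>R partial k (partial 0 f) x)" for k
    using arg_cong[OF *, of "scaleR (x $ k)"] by (simp add: scaleR_add_right mult.commute)
  then show ?thesis
    unfolding euler_vec_def sum.distrib[symmetric] scaleR_sum_right
    by (intro sum.cong refl)
qed

lemma fueter_fueter_plus_laplacian:
  assumes "x \<in> \<Omega>"
  shows "fueter (fueter f) x + laplacian f x = 2 *\<^sub>R fueter (partial 0 f) x"
  using fueter_plus_fueter_conj[of "fueter f" x] fueter_conj_fueter[OF assms]
    partial_eqI[OF has_partial_fueter[OF assms], of 0] by simp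

lemma fueter_conj_nu:
  assumes "x \<in> \<Omega>"
  shows "fueter_conj (nu f) x
    = - fueter_conj (\<lambda>y. qvec y *\<^sub>q partial 0 f y) x + fueter_conj (euler_vec f) x"
proof -
  have *: "has_partial k (\<lambda>y. qvec y *\<^sub>q partial 0 f y)
      (partial k (\<lambda>y. qvec y *\<^sub>q partial 0 f y) x) x" for k
    by (rule has_partial_partial, rule has_partial_qmult[OF has_partial_qvec has_partial2[OF assms]])
  have **: "partial k (nu f) x
      = - partial k (\<lambda>y. qvec y *\<^sub>q partial 0 f y) x + partial k (euler_vec f) x" for k
    unfolding nu_eq_euler_vec[abs_def]
    by (intro partial_eqI has_partial_add has_partial_minus * assms
        has_partial_partial[OF has_partial_euler_vec])
  show ?thesis
    by (simp add: ** fueter_conj_def quat_eq_iff qmult_nth algebra_simps)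
qed

lemma fueter_conj_nu_identity:
  assumes "x \<in> \<Omega>"
  shows "(- 2) *\<^sub>R fueter_conj (nu f) x = fueter_conj (\<lambda>y. qvec y *\<^sub>q fueter f y) x
    + laplacian (\<lambda>y. qvec y *\<^sub>q f y) x + 3 *\<^sub>R fueter_conj f x"
proof -
  let ?X = "qvec x"
  have fueter_partial: "has_partial k (fueter f) (partial k (fueter f) x) x" for k
    using has_partial_fueter[OF assms] by (rule has_partial_partial)
  have "(- 2) *\<^sub>R fueter_conj (nu f) x
      = 2 *\<^sub>R (?X *\<^sub>q fueter (partial 0 f) x + 3 *\<^sub>R partial 0 f x + 2 *\<^sub>R euler_vec (partial 0 f) x)
        - 2 *\<^sub>R (euler_vec (fueter_conj f) x - dirac f x)"
    by (simp add: fueter_conj_nu fueter_conj_euler_vec fueter_conj_qvec_mult has_partial2 assms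
        algebra_simps)
  also have "\<dots> = ?X *\<^sub>q (2 *\<^sub>R fueter (partial 0 f) x) + 3 *\<^sub>R (2 *\<^sub>R partial 0 f x)
      + 2 *\<^sub>R (2 *\<^sub>R euler_vec (partial 0 f) x) - 2 *\<^sub>R euler_vec (fueter_conj f) x
      + 2 *\<^sub>R dirac f x"
    by (simp add: bounded_bilinear.scaleR_right[OF bounded_bilinear_qmult] algebra_simps)
  \<comment> \<open>Every \<open>2 \<partial>\<^sub>0\<close> is split as \<open>D + D'\<close>; the \<open>E D' f\<close> terms then cancel.\<close>
  also have "\<dots> = ?X *\<^sub>q (fueter (fueter f) x + laplacian f x)
      + 3 *\<^sub>R (fueter f x + fueter_conj f x)
      + 2 *\<^sub>R (euler_vec (fueter f) x + euler_vec (fueter_conj f) x)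
      - 2 *\<^sub>R euler_vec (fueter_conj f) x + 2 *\<^sub>R dirac f x"
    by (simp only: fueter_fueter_plus_laplacian[OF assms] fueter_plus_fueter_conj
        euler_vec_fueter_plus_conj[OF assms])
  also have "\<dots> = (?X *\<^sub>q fueter (fueter f) x + 3 *\<^sub>R fueter f x + 2 *\<^sub>R euler_vec (fueter f) x)
      + (?X *\<^sub>q laplacian f x + 2 *\<^sub>R dirac f x) + 3 *\<^sub>R fueter_conj f x"
    by (simp add: bounded_bilinear.add_right[OF bounded_bilinear_qmult] algebra_simps)
  also have "\<dots> = fueter_conj (\<lambda>y. qvec y *\<^sub>q fueter f y) x
      + laplacian (\<lambda>y. qvec y *\<^sub>q f y) x + 3 *\<^sub>R fueter_conj f x"
    by (simp only: fueter_conj_qvec_mult[OF fueter_partial] laplacian_qvec_mult[OF assms])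
  finally show ?thesis .
qed

text \<open>
  On the open set where the vector part does not vanish, the argument of \<open>D'\<close> coincides with \<open>D f\<close>,
  and \<open>D'\<close> at a point depends only on the values nearby.
\<close>

lemma laplacian_identity:
  assumes "x \<in> \<Omega>" "qvec x \<noteq> 0"
  shows "laplacian f x =
    fueter_conj (\<lambda>y. ((1 / (norm (qvec y))\<^sup>2) *\<^sub>R qvec y) *\<^sub>q
      (nu f y - (\<Sum>k\<in>UNIV. qcross (qvec y) (Grad (\<lambda>z. f z $ k) y) *\<^sub>q qe k))) x"
proof -
  let ?S = "\<Omega> \<inter> {y. qvec y \<noteq> 0}"
  have "continuous_on UNIV qvec"
    unfolding qvec_def[abs_def] by (intro continuous_intros)
  then have "open ?S"
    by (intro open_Int opn open_Collect_neq) auto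
  moreover have "((1 / (norm (qvec y))\<^sup>2) *\<^sub>R qvec y) *\<^sub>q
      (nu f y - (\<Sum>k\<in>UNIV. qcross (qvec y) (Grad (\<lambda>z. f z $ k) y) *\<^sub>q qe k)) = fueter f y"
    if "y \<in> ?S" for y
    using that by (subst nu_minus_cross_Grad) (auto intro: has_partial1 qvec_cancel_left)
  moreover have "has_partial k (fueter f) (partial k (fueter f) x) x" for k
    using has_partial_fueter[OF assms(1)] by (rule has_partial_partial)
  ultimately show ?thesis
    using assms fueter_conj_fueter[OF assms(1)]
    by (subst fueter_conj_cong_open[of "fueter f" x ?S]) auto
qed

end

theorem proposition3p7:
  fixes \<Omega> :: "quat set" and f :: "quat \<Rightarrow> quat"
  assumes "open \<Omega>" and "connected \<Omega>" and "\<Omega> \<noteq> {}"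
    and "Ck_on 2 f \<Omega>"
  shows "(\<forall>x\<in>\<Omega>. (- 2) *\<^sub>R fueter_conj (nu f) x =
           fueter_conj (\<lambda>y. qvec y *\<^sub>q fueter f y) x
           + laplacian (\<lambda>y. qvec y *\<^sub>q f y) x
           + 3 *\<^sub>R fueter_conj f x) \<and>
         (\<forall>x\<in>{x \<in> \<Omega>. qvec x \<noteq> 0}. laplacian f x =
           fueter_conj (\<lambda>y. ((1 / (norm (qvec y))\<^sup>2) *\<^sub>R qvec y) *\<^sub>q
             (nu f y - (\<Sum>k\<in>UNIV. qcross (qvec y) (Grad (\<lambda>z. f z $ k) y) *\<^sub>q qe k))) x)"
proof -
  interpret C2_function \<Omega> f
    using assms(1,4) by unfold_locales
  show ?thesis
    using fueter_conj_nu_identity laplacian_identity by blast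
qed

end
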